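(* Let $f$ be a real form of degree $d\ge 2$ in $n$ variables and let $K\subset\mathbb{R}^n$ be a self-dual convex cone. Then $f\in\mathring{\mathrm{SL}}^d(K)$ if and only if for any nonzero $a_1,\dots,a_{d-2}\in K$ the matrix $Q$ of the quadratic form $q=D_{a_1}\cdots D_{a_{d-2}}f$ satisfies the following two conditions: (1) $Q$ is $K$-positive and nonsingular; (2) $Q$ has exactly one positive eigenvalue.
   Context: $K$ is self-dual if $K=K^*=\{y : \langle y,x\rangle\ge 0\ \forall x\in K\}$. $D_af=\sum_i a_i\,\partial f/\partial x_i$. The matrix of a quadratic form $q$ is the symmetric matrix $Q$ with $q(x)=x^tQx$. An $n\times n$ matrix $A$ is $K$-positive if $Ax\in\mathrm{int}\,K$ for every nonzero $x\in K$. A form $f$ of degree $d\ge2$ is $K$-Lorentzian if for all $a_1,\dots,a_{d-2}\in\mathrm{int}\,K$ the matrix $Q$ of $D_{a_1}\cdots D_{a_{d-2}}f$ has exactly one positive eigenvalue and satisfies $y^tQx>0$ for all $x,y\in\mathrm{int}\,K$. $\mathring{\mathrm{SL}}^d(K)$ is the set of $K$-Lorentzian forms $f$ of degree $d$ such that, in addition, for all nonzero $a_1,\dots,a_{d-2}\in K$ the matrix $Q$ of $D_{a_1}\cdots D_{a_{d-2}}f$ is nonsingular and $x^tQy>0$ for all nonzero $x,y\in K$. *)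

theory Defs
  imports "HOL-Analysis.Analysis"
begin

(* Real forms in the variables indexed by 'n, given as polynomial functions: over the infinite
   field of reals a polynomial and its function determine each other. The index set of the sum is
   finite (finite_multi_indices below). The zero polynomial is a form of every degree. *)
definition real_form :: "nat \<Rightarrow> (real^'n \<Rightarrow> real) \<Rightarrow> bool" where
  "real_form d f \<longleftrightarrow>
     (\<exists>c :: ('n \<Rightarrow> nat) \<Rightarrow> real. \<forall>x.
        f x = (\<Sum>\<alpha> \<in> {\<alpha>. (\<Sum>i\<in>UNIV. \<alpha> i) = d}. c \<alpha> * (\<Prod>i\<in>UNIV. x $ i ^ \<alpha> i)))"

lemma finite_multi_indices: "finite {\<alpha> :: 'n::finite \<Rightarrow> nat. (\<Sum>i\<in>UNIV. \<alpha> i) = d}"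
proof (rule finite_subset)
  show "{\<alpha> :: 'n \<Rightarrow> nat. (\<Sum>i\<in>UNIV. \<alpha> i) = d} \<subseteq> PiE UNIV (\<lambda>_. {..d})"
    by (auto intro: member_le_sum)
  show "finite (PiE (UNIV :: 'n set) (\<lambda>_. {..d}))"
    by (intro finite_PiE) auto
qed

definition partial_deriv :: "'n \<Rightarrow> (real^'n \<Rightarrow> real) \<Rightarrow> real^'n \<Rightarrow> real" where
  "partial_deriv i f x = deriv (\<lambda>t. f (x + t *\<^sub>R axis i 1)) 0"

definition dir_deriv :: "real^'n \<Rightarrow> (real^'n \<Rightarrow> real) \<Rightarrow> real^'n \<Rightarrow> real" where
  "dir_deriv a f = (\<lambda>x. \<Sum>i\<in>UNIV. a $ i * partial_deriv i f x)"

(* iter_dir_deriv [a1, ..., ak] f = D_a1 (... (D_ak f)) *)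
definition iter_dir_deriv :: "(real^'n) list \<Rightarrow> (real^'n \<Rightarrow> real) \<Rightarrow> real^'n \<Rightarrow> real" where
  "iter_dir_deriv as f = foldr dir_deriv as f"

(* Meaningful only if q is a quadratic form; uniqueness is quad_matrix_eqI below. *)
definition quad_matrix :: "(real^'n \<Rightarrow> real) \<Rightarrow> real^'n^'n" where
  "quad_matrix q = (THE Q. transpose Q = Q \<and> (\<forall>x. q x = x \<bullet> (Q *v x)))"

lemma quad_matrix_eqI:
  fixes Q :: "real^'n^'n"
  assumes sym: "transpose Q = Q" and q: "\<And>x. q x = x \<bullet> (Q *v x)"
  shows "quad_matrix q = Q"
  unfolding quad_matrix_def
proof (rule the_equality)
  show "transpose Q = Q \<and> (\<forall>x. q x = x \<bullet> (Q *v x))"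
    using assms by simp
next
  fix P :: "real^'n^'n"
  assume P: "transpose P = P \<and> (\<forall>x. q x = x \<bullet> (P *v x))"
  have polar: "2 * (y \<bullet> (M *v x)) = q (x + y) - q x - q y"
    if M: "transpose M = M" "\<forall>x. q x = x \<bullet> (M *v x)" for M :: "real^'n^'n" and x y
  proof -
    have "x \<bullet> (M *v y) = y \<bullet> (M *v x)"
      by (metis dot_lmul_matrix inner_commute transpose_matrix_vector M(1))
    then show ?thesis
      using M(2) by (simp add: matrix_vector_right_distrib inner_add_left inner_add_right)
  qed
  have "y \<bullet> (P *v x) = y \<bullet> (Q *v x)" for x y
    using polar[of P y x] polar[of Q y x] P sym q by simp
  then have "P *v x = Q *v x" for x
    by (metis vector_eq_ldot)
  then show "P = Q"
    by (simp add: matrix_eq)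
qed

definition positive_eigenvalues :: "real^'n^'n \<Rightarrow> real set" where
  "positive_eigenvalues Q = {l. 0 < l \<and> (\<exists>v. v \<noteq> 0 \<and> Q *v v = l *\<^sub>R v)}"

(* Counted with multiplicity. This is used for symmetric matrices only, for which the geometric
   and the algebraic multiplicity of an eigenvalue agree. *)
definition num_positive_eigenvalues :: "real^'n^'n \<Rightarrow> nat" where
  "num_positive_eigenvalues Q = (\<Sum>l\<in>positive_eigenvalues Q. dim {v. Q *v v = l *\<^sub>R v})"

definition dual_cone :: "(real^'n) set \<Rightarrow> (real^'n) set" where
  "dual_cone K = {y. \<forall>x\<in>K. y \<bullet> x \<ge> 0}"

definition self_dual :: "(real^'n) set \<Rightarrow> bool" where
  "self_dual K \<longleftrightarrow> K = dual_cone K"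

definition K_positive :: "(real^'n) set \<Rightarrow> real^'n^'n \<Rightarrow> bool" where
  "K_positive K A \<longleftrightarrow> (\<forall>x\<in>K. x \<noteq> 0 \<longrightarrow> A *v x \<in> interior K)"

definition K_Lorentzian :: "(real^'n) set \<Rightarrow> nat \<Rightarrow> (real^'n \<Rightarrow> real) \<Rightarrow> bool" where
  "K_Lorentzian K d f \<longleftrightarrow> 2 \<le> d \<and> real_form d f \<and>
     (\<forall>as. length as = d - 2 \<and> set as \<subseteq> interior K \<longrightarrow>
        (let Q = quad_matrix (iter_dir_deriv as f) in
           num_positive_eigenvalues Q = 1 \<and>
           (\<forall>x\<in>interior K. \<forall>y\<in>interior K. y \<bullet> (Q *v x) > 0)))"

(* The set written SL with superscripts d and a ring, of K. *)
definition SL_ring :: "nat \<Rightarrow> (real^'n) set \<Rightarrow> (real^'n \<Rightarrow> real) set" where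
  "SL_ring d K = {f. K_Lorentzian K d f \<and>
     (\<forall>as. length as = d - 2 \<and> set as \<subseteq> K - {0} \<longrightarrow>
        (let Q = quad_matrix (iter_dir_deriv as f) in
           invertible Q \<and>
           (\<forall>x \<in> K - {0}. \<forall>y \<in> K - {0}. x \<bullet> (Q *v y) > 0)))}"

end

theory Submission
  imports Defs
begin

text \<open>
  Self-duality gives the description of the interior on which everything rests
  (\<open>interior_self_dual\<close>): \<open>z\<close> is interior to \<open>K\<close> iff \<open>z \<bullet> x > 0\<close> for every nonzero \<open>x\<close> in \<open>K\<close>. Hence
  a matrix \<open>Q\<close> is \<open>K\<close>-positive iff \<open>x \<bullet> (Q *v y) > 0\<close> for all nonzero \<open>x\<close> and \<open>y\<close> in \<open>K\<close>, and the
  two sides of the equivalence differ only in where they ask for a single positive eigenvalue: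
  for directions in the interior of \<open>K\<close>, or for all nonzero directions in \<open>K\<close>. Interior vectors
  are nonzero, which settles one implication.

  For the other one, directions \<open>a\<^sub>i\<close> in \<open>K\<close> are approximated by \<open>a\<^sub>i + t e\<close> with \<open>e\<close>
  interior and \<open>t > 0\<close>; these are interior, and as \<open>t\<close> tends to \<open>0\<close> the quadratic forms converge
  because the coefficients of an iterated directional derivative are polynomial in the
  directions. Two facts about the limit matrix \<open>Q\<close> then suffice. It has a positive eigenvalue,
  since \<open>e \<bullet> (Q *v e) > 0\<close> and the maximum of the Rayleigh quotient is an eigenvalue. It has no
  second one: two orthogonal eigenvectors with positive eigenvalues would span a plane on which
  \<open>Q\<close> is positive definite, so the approximating matrices would eventually be positive definite
  on that plane; but a matrix with a single positive eigenvalue is nonpositive on a hyperplane,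
  and the plane contains a nonzero vector of every hyperplane
  (\<open>num_positive_eigenvalues_eq_1_limit\<close>).
\<close>

section \<open>Forms and their directional derivatives\<close>

definition form_of :: "nat \<Rightarrow> (('n \<Rightarrow> nat) \<Rightarrow> real) \<Rightarrow> real^'n \<Rightarrow> real" where
  "form_of d c x = (\<Sum>\<alpha> \<in> {\<alpha>. (\<Sum>i\<in>UNIV. \<alpha> i) = d}. c \<alpha> * (\<Prod>i\<in>UNIV. x $ i ^ \<alpha> i))"

lemma real_form_iff_form_of: "real_form d f \<longleftrightarrow> (\<exists>c. f = form_of d c)"
  by (auto simp: real_form_def form_of_def fun_eq_iff)

text \<open>The change of index \<open>\<alpha> = \<beta> + e\<^sub>i\<close>, which pairs the \<open>\<alpha>\<close> with \<open>\<alpha> i \<noteq> 0\<close> with all \<open>\<beta>\<close> of degree one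
  less; the factor \<open>\<alpha> i\<close> removes the other \<open>\<alpha>\<close>. Both the coefficients of a partial derivative and
  Euler's identity come from it.\<close>

lemma sum_multi_index_shift:
  fixes F :: "('n::finite \<Rightarrow> nat) \<Rightarrow> real"
  shows "(\<Sum>\<alpha> | (\<Sum>j\<in>UNIV. \<alpha> j) = Suc d. real (\<alpha> i) * F \<alpha>) =
    (\<Sum>\<beta> | (\<Sum>j\<in>UNIV. \<beta> j) = d. real (Suc (\<beta> i)) * F (\<beta>(i := Suc (\<beta> i))))"
proof -
  have upd: "(\<Sum>j\<in>UNIV. (\<beta>(i := k)) j) + \<beta> i = k + (\<Sum>j\<in>UNIV. \<beta> j)"
    for \<beta> :: "'n \<Rightarrow> nat" and k
    by (simp add: sum.remove[of UNIV i])
  have "(\<Sum>\<alpha> | (\<Sum>j\<in>UNIV. \<alpha> j) = Suc d. real (\<alpha> i) * F \<alpha>) =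
    (\<Sum>\<alpha> | (\<Sum>j\<in>UNIV. \<alpha> j) = Suc d \<and> \<alpha> i \<noteq> 0. real (\<alpha> i) * F \<alpha>)"
    by (rule sum.mono_neutral_right) (auto simp: finite_multi_indices)
  also have "\<dots> = (\<Sum>\<beta> | (\<Sum>j\<in>UNIV. \<beta> j) = d. real (Suc (\<beta> i)) * F (\<beta>(i := Suc (\<beta> i))))"
  proof (rule sum.reindex_bij_witness
      [where i = "\<lambda>\<beta>. \<beta>(i := Suc (\<beta> i))" and j = "\<lambda>\<alpha>. \<alpha>(i := \<alpha> i - 1)"])
    fix \<alpha> :: "'n \<Rightarrow> nat" assume "\<alpha> \<in> {\<alpha>. (\<Sum>j\<in>UNIV. \<alpha> j) = Suc d \<and> \<alpha> i \<noteq> 0}"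
    then show "\<alpha>(i := \<alpha> i - 1) \<in> {\<beta>. (\<Sum>j\<in>UNIV. \<beta> j) = d}"
      using upd[of \<alpha> "\<alpha> i - 1"] by simp
  next
    fix \<beta> :: "'n \<Rightarrow> nat" assume "\<beta> \<in> {\<beta>. (\<Sum>j\<in>UNIV. \<beta> j) = d}"
    then show "\<beta>(i := Suc (\<beta> i)) \<in> {\<alpha>. (\<Sum>j\<in>UNIV. \<alpha> j) = Suc d \<and> \<alpha> i \<noteq> 0}"
      using upd[of \<beta> "Suc (\<beta> i)"] by simp
  qed auto
  finally show ?thesis .
qed

lemma monomial_has_partial_derivative:
  fixes x :: "real^'n"
  shows "((\<lambda>t. \<Prod>j\<in>UNIV. (x + t *\<^sub>R axis i 1) $ j ^ \<alpha> j) has_field_derivative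
    real (\<alpha> i) * (\<Prod>j\<in>UNIV. x $ j ^ (\<alpha>(i := \<alpha> i - 1)) j)) (at 0)"
proof -
  let ?R = "\<Prod>j\<in>UNIV - {i}. x $ j ^ \<alpha> j"
  have *: "(\<Prod>j\<in>UNIV. (x + t *\<^sub>R axis i 1) $ j ^ \<alpha> j) = (x $ i + t) ^ \<alpha> i * ?R" for t
  proof -
    have "(\<Prod>j\<in>UNIV - {i}. (x + t *\<^sub>R axis i 1) $ j ^ \<alpha> j) = ?R"
      by (rule prod.cong) (auto simp: axis_def)
    then show ?thesis by (simp add: prod.remove[of UNIV i] axis_def)
  qed
  have "(\<Prod>j\<in>UNIV. x $ j ^ (\<alpha>(i := \<alpha> i - 1)) j) = x $ i ^ (\<alpha> i - 1) * ?R"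
    by (simp add: prod.remove[of UNIV i])
  then show ?thesis
    unfolding * by (auto intro!: derivative_eq_intros)
qed

lemma partial_deriv_form_of:
  "partial_deriv i (form_of (Suc d) c) =
    form_of d (\<lambda>\<alpha>. real (Suc (\<alpha> i)) * c (\<alpha>(i := Suc (\<alpha> i))))"
proof
  fix x
  have "((\<lambda>t. form_of (Suc d) c (x + t *\<^sub>R axis i 1)) has_field_derivative
    (\<Sum>\<alpha> | (\<Sum>j\<in>UNIV. \<alpha> j) = Suc d.
       c \<alpha> * (real (\<alpha> i) * (\<Prod>j\<in>UNIV. x $ j ^ (\<alpha>(i := \<alpha> i - 1)) j)))) (at 0)"
    unfolding form_of_def by (intro DERIV_sum DERIV_cmult monomial_has_partial_derivative)
  then have "partial_deriv i (form_of (Suc d) c) x = (\<Sum>\<alpha> | (\<Sum>j\<in>UNIV. \<alpha> j) = Suc d.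
       real (\<alpha> i) * (c \<alpha> * (\<Prod>j\<in>UNIV. x $ j ^ (\<alpha>(i := \<alpha> i - 1)) j)))"
    unfolding partial_deriv_def by (simp add: DERIV_imp_deriv mult_ac)
  also have "\<dots> = form_of d (\<lambda>\<alpha>. real (Suc (\<alpha> i)) * c (\<alpha>(i := Suc (\<alpha> i)))) x"
    unfolding form_of_def sum_multi_index_shift by (simp add: mult_ac)
  finally show "partial_deriv i (form_of (Suc d) c) x =
    form_of d (\<lambda>\<alpha>. real (Suc (\<alpha> i)) * c (\<alpha>(i := Suc (\<alpha> i)))) x" .
qed

definition deriv_coeffs :: "real^'n \<Rightarrow> (('n \<Rightarrow> nat) \<Rightarrow> real) \<Rightarrow> ('n \<Rightarrow> nat) \<Rightarrow> real" where
  "deriv_coeffs a c \<alpha> = (\<Sum>i\<in>UNIV. a $ i * (real (Suc (\<alpha> i)) * c (\<alpha>(i := Suc (\<alpha> i)))))"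

lemma dir_deriv_form_of: "dir_deriv a (form_of (Suc d) c) = form_of d (deriv_coeffs a c)"
proof
  fix x
  show "dir_deriv a (form_of (Suc d) c) x = form_of d (deriv_coeffs a c) x"
    unfolding dir_deriv_def partial_deriv_form_of form_of_def deriv_coeffs_def
      sum_distrib_left sum_distrib_right
    by (subst sum.swap) (simp add: mult.assoc)
qed

lemma iter_dir_deriv_form_of:
  "iter_dir_deriv as (form_of (d + length as) c) = form_of d (foldr deriv_coeffs as c)"
proof (induction as arbitrary: d)
  case Nil
  then show ?case by (simp add: iter_dir_deriv_def)
next
  case (Cons a as)
  then show ?case
    using Cons.IH[of "Suc d"] by (simp add: iter_dir_deriv_def dir_deriv_form_of)
qed

text \<open>Working with coefficients reduces the continuous dependence of an iterated derivative on its
  directions to continuity of finite sums of products.\<close>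

lemma tendsto_foldr_deriv_coeffs:
  assumes "(t \<longlongrightarrow> (0::real)) F"
  shows "((\<lambda>k. foldr deriv_coeffs (map (\<lambda>a. a + t k *\<^sub>R e) as) c \<alpha>)
    \<longlongrightarrow> foldr deriv_coeffs as c \<alpha>) F"
proof (induction as arbitrary: \<alpha>)
  case (Cons a as)
  have "((\<lambda>k. a $ i + t k * e $ i) \<longlongrightarrow> a $ i) F" for i
    by (rule tendsto_eq_intros assms refl | simp)+
  then have "((\<lambda>k. deriv_coeffs (a + t k *\<^sub>R e)
      (foldr deriv_coeffs (map (\<lambda>a. a + t k *\<^sub>R e) as) c) \<alpha>)
    \<longlongrightarrow> deriv_coeffs a (foldr deriv_coeffs as c) \<alpha>) F"
    unfolding deriv_coeffs_def[of _ _ \<alpha>] vector_add_component vector_scaleR_component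
      real_scaleR_def
    by (intro tendsto_intros Cons.IH)
  then show ?case by simp
qed simp

lemma tendsto_form_of:
  assumes "\<And>\<alpha>. ((\<lambda>k. c k \<alpha>) \<longlongrightarrow> c0 \<alpha>) F"
  shows "((\<lambda>k. form_of d (c k) x) \<longlongrightarrow> form_of d c0 x) F"
  unfolding form_of_def by (intro tendsto_intros assms)

text \<open>Euler's identity, from \<open>(\<Sum>i. \<alpha> i) x^\<alpha> = (d + 1) x^\<alpha>\<close> for each monomial. Applied twice, it
  writes a form of degree 2 by means of a matrix.\<close>

lemma euler_form_of:
  "real (Suc d) * form_of (Suc d) c x =
    (\<Sum>i\<in>UNIV. x $ i * partial_deriv i (form_of (Suc d) c) x)"
proof -
  let ?m = "\<lambda>\<alpha>. \<Prod>j\<in>UNIV. x $ j ^ \<alpha> j"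
  have m: "?m (\<alpha>(i := Suc (\<alpha> i))) = x $ i * ?m \<alpha>" for \<alpha> i
    by (simp add: prod.remove[of UNIV i])
  have "x $ i * partial_deriv i (form_of (Suc d) c) x =
    (\<Sum>\<alpha> | (\<Sum>j\<in>UNIV. \<alpha> j) = Suc d. real (\<alpha> i) * (c \<alpha> * ?m \<alpha>))" for i
    unfolding partial_deriv_form_of sum_multi_index_shift m
    by (simp add: form_of_def sum_distrib_left mult_ac)
  then have "(\<Sum>i\<in>UNIV. x $ i * partial_deriv i (form_of (Suc d) c) x) =
    (\<Sum>\<alpha> | (\<Sum>j\<in>UNIV. \<alpha> j) = Suc d. \<Sum>i\<in>UNIV. real (\<alpha> i) * (c \<alpha> * ?m \<alpha>))"
    by (simp add: sum.swap[of _ _ UNIV])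
  also have "\<dots> = real (Suc d) * form_of (Suc d) c x"
    unfolding form_of_def sum_distrib_left
    by (rule sum.cong) (simp_all flip: sum_distrib_right of_nat_sum)
  finally show ?thesis by simp
qed

lemma form_of_0: "form_of 0 c x = c (\<lambda>_. 0)"
proof -
  have "{\<alpha> :: 'a::finite \<Rightarrow> nat. (\<Sum>i\<in>UNIV. \<alpha> i) = 0} = {\<lambda>_. 0}"
    by (auto simp: fun_eq_iff)
  then show ?thesis by (simp add: form_of_def)
qed

text \<open>The definite description in \<^const>\<open>quad_matrix\<close> is meaningful on forms of degree 2: with
  \<open>\<partial>\<^sub>i q = (\<Sum>j. m i j x\<^sub>j)\<close>, Euler's identity gives \<open>2 q(x) = (\<Sum>i. \<Sum>j. x\<^sub>i m i j x\<^sub>j)\<close>.\<close>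

lemma quad_matrix_form_of:
  fixes c :: "('n::finite \<Rightarrow> nat) \<Rightarrow> real"
  shows "transpose (quad_matrix (form_of 2 c)) = quad_matrix (form_of 2 c)"
    and "form_of 2 c x = x \<bullet> (quad_matrix (form_of 2 c) *v x)"
proof -
  define c' where "c' = (\<lambda>i \<alpha>. real (Suc (\<alpha> i)) * c (\<alpha>(i := Suc (\<alpha> i))))"
  have c': "partial_deriv i (form_of 2 c) = form_of 1 (c' i)" for i
    using partial_deriv_form_of[of i 1 c] by (simp add: numeral_2_eq_2 c'_def)
  obtain m where m: "\<And>i x. form_of 1 (c' i) x = (\<Sum>j\<in>UNIV. x $ j * m i j)"
  proof
    fix i x
    show "form_of 1 (c' i) x = (\<Sum>j\<in>UNIV. x $ j * c' i (\<lambda>k. if k = j then Suc 0 else 0))"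
      using euler_form_of[of 0 "c' i" x]
      by (simp add: partial_deriv_form_of form_of_0 fun_upd_def)
  qed
  \<comment> \<open>One factor 1/2 comes from Euler's identity, the other from symmetrizing \<open>m\<close>.\<close>
  define Q :: "real^'n^'n" where "Q = (\<chi> i j. (m i j + m j i) / 4)"
  have sym: "transpose Q = Q"
    by (simp add: Q_def transpose_def vec_eq_iff add.commute)
  have eq: "form_of 2 c x = x \<bullet> (Q *v x)" for x
  proof -
    have a: "2 * form_of 2 c x = (\<Sum>i\<in>UNIV. \<Sum>j\<in>UNIV. x $ i * x $ j * m i j)"
      using euler_form_of[of 1 c x] c' m
      by (simp add: numeral_2_eq_2 sum_distrib_left mult_ac)
    have b: "(\<Sum>i\<in>UNIV. \<Sum>j\<in>UNIV. x $ i * x $ j * m j i) =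
      (\<Sum>i\<in>UNIV. \<Sum>j\<in>UNIV. x $ i * x $ j * m i j)"
      by (subst sum.swap) (simp add: mult_ac)
    have "x \<bullet> (Q *v x) = (\<Sum>i\<in>UNIV. \<Sum>j\<in>UNIV. x $ i * x $ j * ((m i j + m j i) / 4))"
      by (simp add: inner_vec_def matrix_vector_mult_def Q_def sum_distrib_left mult_ac)
    also have "\<dots> = (\<Sum>i\<in>UNIV. \<Sum>j\<in>UNIV. x $ i * x $ j * m i j) / 4
        + (\<Sum>i\<in>UNIV. \<Sum>j\<in>UNIV. x $ i * x $ j * m j i) / 4"
      by (simp add: sum_divide_distrib add_divide_distrib distrib_left flip: sum.distrib)
    finally show ?thesis using a b by simp
  qed
  have "quad_matrix (form_of 2 c) = Q"
    using sym eq by (rule quad_matrix_eqI)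
  then show "transpose (quad_matrix (form_of 2 c)) = quad_matrix (form_of 2 c)"
    and "form_of 2 c x = x \<bullet> (quad_matrix (form_of 2 c) *v x)"
    using sym eq by simp_all
qed

section \<open>Counting positive eigenvalues\<close>

lemma inner_symmetric_matrix:
  fixes Q :: "real^'n^'n"
  assumes "transpose Q = Q"
  shows "(Q *v x) \<bullet> y = x \<bullet> (Q *v y)"
  by (metis assms dot_lmul_matrix transpose_matrix_vector)

text \<open>A maximizer of the Rayleigh quotient on the unit sphere of an invariant subspace is an
  eigenvector, and the maximum, its eigenvalue, is positive as soon as the quadratic form is
  positive somewhere on the subspace.\<close>

lemma rayleigh_eigenvector:
  fixes Q :: "real^'n^'n"
  assumes sym: "transpose Q = Q" and V: "subspace V" and inv: "\<And>x. x \<in> V \<Longrightarrow> Q *v x \<in> V"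
    and w: "w \<in> V" "w \<bullet> (Q *v w) > 0"
  shows "\<exists>v\<in>V. \<exists>l>0. v \<noteq> 0 \<and> Q *v v = l *\<^sub>R v"
proof -
  let ?q = "\<lambda>x. x \<bullet> (Q *v x)"
  have scale: "?q (s *\<^sub>R x) = s\<^sup>2 * ?q x" for s x
    by (simp add: matrix_vector_mult_scaleR power2_eq_square)
  have w0: "w \<noteq> 0" using w(2) by auto
  define w' where "w' = (1 / norm w) *\<^sub>R w"
  have w': "w' \<in> V \<inter> sphere 0 1" "?q w' > 0"
    using w w0 V unfolding w'_def scale by (auto simp: subspace_scale)
  have "compact (V \<inter> sphere 0 1)"
    by (simp add: V closed_subspace closed_Int_compact)
  moreover have "continuous_on (V \<inter> sphere 0 1) ?q"
    by (intro continuous_intros matrix_vector_mult_linear_continuous_on)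
  ultimately obtain v where v: "v \<in> V \<inter> sphere 0 1" and
    max: "\<And>y. y \<in> V \<inter> sphere 0 1 \<Longrightarrow> ?q y \<le> ?q v"
    using continuous_attains_sup[of "V \<inter> sphere 0 1" ?q] w'(1) by blast
  define l where "l = ?q v"
  have l: "l > 0" using max[OF w'(1)] w'(2) by (simp add: l_def)
  have bound: "?q y \<le> l * (norm y)\<^sup>2" if "y \<in> V" for y
  proof (cases "y = 0")
    case False
    then have "?q ((1 / norm y) *\<^sub>R y) \<le> l"
      unfolding l_def using that V by (intro max) (auto simp: subspace_scale)
    then show ?thesis using False by (simp only: scale) (simp add: field_simps power_divide)
  qed simp
  \<comment> \<open>Moving from \<open>v\<close> along the residual \<open>r\<close> raises the quotient to first order by a multiple of
    \<open>r \<bullet> r\<close>, so maximality forces \<open>r = 0\<close>. Invariance of \<open>V\<close> keeps the path inside \<open>V\<close>.\<close>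
  define r where "r = Q *v v - l *\<^sub>R v"
  have rV: "r \<in> V"
    unfolding r_def using v V inv by (auto intro!: subspace_diff subspace_scale)
  define C where "C = l * (r \<bullet> r) - ?q r"
  have key: "2 * t * (r \<bullet> r) \<le> t\<^sup>2 * C" for t
  proof -
    have "?q (v + t *\<^sub>R r) \<le> l * (norm (v + t *\<^sub>R r))\<^sup>2"
      using bound v rV V by (auto intro!: subspace_add subspace_scale)
    moreover have "?q (v + t *\<^sub>R r) = l + 2 * t * (r \<bullet> (Q *v v)) + t\<^sup>2 * ?q r"
      using inner_symmetric_matrix[OF sym, of r v]
      by (simp add: l_def algebra_simps matrix_vector_mult_scaleR power2_eq_square
          inner_commute)
    moreover have "(norm (v + t *\<^sub>R r))\<^sup>2 = 1 + 2 * t * (r \<bullet> v) + t\<^sup>2 * (r \<bullet> r)"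
    proof -
      have "v \<bullet> v = 1" using v by (simp add: dot_square_norm)
      then show ?thesis
        unfolding power2_norm_eq_inner
        by (simp add: algebra_simps power2_eq_square inner_commute)
    qed
    moreover have "r \<bullet> r = r \<bullet> (Q *v v) - l * (r \<bullet> v)"
      by (simp add: r_def inner_diff_right)
    ultimately have "l + 2 * t * (r \<bullet> (Q *v v)) + t\<^sup>2 * ?q r \<le>
        l * (1 + 2 * t * (r \<bullet> v) + t\<^sup>2 * (r \<bullet> r))"
      and "2 * t * (r \<bullet> r) = 2 * t * (r \<bullet> (Q *v v)) - l * (2 * t * (r \<bullet> v))"
      by (simp_all add: right_diff_distrib mult_ac)
    then show ?thesis by (simp add: C_def algebra_simps)
  qed
  have "r \<bullet> r = 0"
  proof (rule ccontr)
    assume "r \<bullet> r \<noteq> 0"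
    then have pos: "r \<bullet> r > 0" by simp
    have "2 * (r \<bullet> r) \<le> C" using key[of 1] by simp
    then have C: "C > 0" using pos by linarith
    have "2 * ((r \<bullet> r) * (r \<bullet> r) / C) \<le> (r \<bullet> r) * (r \<bullet> r) / C"
      using key[of "(r \<bullet> r) / C"] C by (simp add: power2_eq_square)
    moreover have "0 < (r \<bullet> r) * (r \<bullet> r) / C" using C pos by (intro divide_pos_pos mult_pos_pos)
    ultimately show False by linarith
  qed
  then have "Q *v v = l *\<^sub>R v" by (simp add: r_def)
  moreover have "v \<noteq> 0" using v by auto
  ultimately show ?thesis using v l by blast
qed

lemma eigenvectors_orthogonal:
  fixes Q :: "real^'n^'n"
  assumes "transpose Q = Q" "Q *v v = l *\<^sub>R v" "Q *v w = m *\<^sub>R w" "l \<noteq> m"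
  shows "v \<bullet> w = 0"
  using inner_symmetric_matrix[OF assms(1), of v w] assms by simp

text \<open>Eigenvectors for different eigenvalues are orthogonal, hence independent. Without finiteness
  the sum that counts the eigenvalues would be \<open>0\<close> by convention.\<close>

lemma finite_positive_eigenvalues:
  fixes Q :: "real^'n^'n"
  assumes sym: "transpose Q = Q"
  shows "finite (positive_eigenvalues Q)"
proof -
  have "\<forall>l\<in>positive_eigenvalues Q. \<exists>v. v \<noteq> 0 \<and> Q *v v = l *\<^sub>R v"
    by (auto simp: positive_eigenvalues_def)
  then obtain v where v: "\<And>l. l \<in> positive_eigenvalues Q \<Longrightarrow> v l \<noteq> 0 \<and> Q *v v l = l *\<^sub>R v l"
    by metis
  have orth: "v l \<bullet> v m = 0"
    if "l \<in> positive_eigenvalues Q" "m \<in> positive_eigenvalues Q" "l \<noteq> m" for l m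
    using eigenvectors_orthogonal[OF sym] v that by blast
  have "inj_on v (positive_eigenvalues Q)"
  proof (rule inj_onI, rule ccontr)
    fix l m assume "l \<in> positive_eigenvalues Q" "m \<in> positive_eigenvalues Q"
      "v l = v m" "l \<noteq> m"
    then show False using orth[of l m] v[of m] by simp
  qed
  moreover have "independent (v ` positive_eigenvalues Q)"
  proof (rule pairwise_orthogonal_independent)
    show "pairwise orthogonal (v ` positive_eigenvalues Q)"
      using orth by (auto simp: pairwise_def orthogonal_def)
    show "0 \<notin> v ` positive_eigenvalues Q" using v by force
  qed
  then have "finite (v ` positive_eigenvalues Q)"
    by (rule independent_imp_finite)
  ultimately show ?thesis by (simp add: finite_image_iff)
qed

text \<open>Orthogonal pairs of eigenvectors treat two distinct positive eigenvalues and one positive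
  eigenvalue with a multidimensional eigenspace alike, so later arguments need no count of
  multiplicities.\<close>

lemma num_positive_eigenvalues_eq_1_iff:
  fixes Q :: "real^'n^'n"
  assumes sym: "transpose Q = Q"
  shows "num_positive_eigenvalues Q = 1 \<longleftrightarrow> positive_eigenvalues Q \<noteq> {} \<and>
    \<not> (\<exists>v w l m. v \<noteq> 0 \<and> w \<noteq> 0 \<and> 0 < l \<and> 0 < m \<and> v \<bullet> w = 0 \<and>
        Q *v v = l *\<^sub>R v \<and> Q *v w = m *\<^sub>R w)"
    (is "_ \<longleftrightarrow> _ \<and> \<not> ?two")
proof -
  let ?P = "positive_eigenvalues Q" and ?E = "\<lambda>l. {v. Q *v v = l *\<^sub>R v}"
  note fin = finite_positive_eigenvalues[OF sym]
  have dim: "1 \<le> dim (?E l)" if "Q *v v = l *\<^sub>R v" "v \<noteq> 0" for v l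
  proof -
    have "dim {v} \<le> dim (?E l)" by (rule dim_subset) (use that in auto)
    then show ?thesis using that by simp
  qed
  show ?thesis
  proof (intro iffI conjI notI)
    assume one: "num_positive_eigenvalues Q = 1"
    show False if "?P = {}"
      using one that by (simp add: num_positive_eigenvalues_def)
    assume ?two
    then obtain v w l m where *: "v \<noteq> 0" "w \<noteq> 0" "0 < l" "0 < m" "v \<bullet> w = 0"
      "Q *v v = l *\<^sub>R v" "Q *v w = m *\<^sub>R w" by blast
    then have mem: "l \<in> ?P" "m \<in> ?P" by (auto simp: positive_eigenvalues_def)
    show False
    proof (cases "l = m")
      case True
      have vw: "v \<noteq> w" using * by auto
      have "independent {v, w}"
        by (rule pairwise_orthogonal_independent)
           (use * in \<open>auto simp: pairwise_insert orthogonal_def inner_commute\<close>)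
      then have "dim {v, w} = 2" using vw by (simp add: dim_eq_card_independent)
      moreover have "dim {v, w} \<le> dim (?E l)" by (rule dim_subset) (use * True in auto)
      moreover have "dim (?E l) \<le> (\<Sum>l\<in>?P. dim (?E l))"
        by (rule member_le_sum) (use mem fin in auto)
      ultimately show False using one by (simp add: num_positive_eigenvalues_def)
    next
      case False
      have "(\<Sum>l\<in>{l, m}. dim (?E l)) \<le> (\<Sum>l\<in>?P. dim (?E l))"
        by (rule sum_mono2) (use mem fin in auto)
      then show False
        using one False dim[of v l] dim[of w m] * by (simp add: num_positive_eigenvalues_def)
    qed
  next
    assume "?P \<noteq> {} \<and> \<not> ?two"
    then have two: "\<not> ?two" and "?P \<noteq> {}" by auto
    then obtain l v where lv: "0 < l" "v \<noteq> 0" "Q *v v = l *\<^sub>R v"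
      by (auto simp: positive_eigenvalues_def)
    have "m = l" if "m \<in> ?P" for m
    proof (rule ccontr)
      assume "m \<noteq> l"
      moreover have "0 < m \<and> (\<exists>w. w \<noteq> 0 \<and> Q *v w = m *\<^sub>R w)"
        using that by (simp add: positive_eigenvalues_def)
      ultimately show False
        using two lv eigenvectors_orthogonal[OF sym lv(3)] by metis
    qed
    then have P: "?P = {l}" using lv by (auto simp: positive_eigenvalues_def)
    \<comment> \<open>Removing from an eigenvector its component along \<open>v\<close> leaves an eigenvector orthogonal to
      \<open>v\<close>, or zero.\<close>
    have "?E l \<subseteq> span {v}"
    proof
      fix x assume x: "x \<in> ?E l"
      let ?y = "x - ((x \<bullet> v) / (v \<bullet> v)) *\<^sub>R v"
      have "Q *v ?y = l *\<^sub>R ?y"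
        using x lv by (simp add: matrix_vector_mult_diff_distrib matrix_vector_mult_scaleR
            scaleR_right_diff_distrib)
      moreover have "v \<bullet> ?y = 0" using lv by (simp add: inner_diff_right inner_commute)
      ultimately have "?y = 0" using two lv by metis
      then have "x = ((x \<bullet> v) / (v \<bullet> v)) *\<^sub>R v" by simp
      then show "x \<in> span {v}" by (metis span_base singletonI span_scale)
    qed
    then have "dim (?E l) \<le> dim {v}" by (rule dim_subset[THEN order_trans]) simp
    then have "dim (?E l) = 1" using dim[of v l] lv by simp
    then show "num_positive_eigenvalues Q = 1"
      by (simp add: num_positive_eigenvalues_def P)
  qed
qed

text \<open>The hyperplane is the orthogonal complement of the positive eigenvector \<open>u\<close>. It is invariant, so
  if the quadratic form were positive somewhere on it, the Rayleigh quotient would produce a second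
  positive eigenvector orthogonal to \<open>u\<close>.\<close>

lemma one_positive_eigenvalue_hyperplane:
  fixes Q :: "real^'n^'n"
  assumes sym: "transpose Q = Q" and one: "num_positive_eigenvalues Q = 1"
  obtains u where "\<And>x. u \<bullet> x = 0 \<Longrightarrow> x \<bullet> (Q *v x) \<le> 0"
proof -
  note one' = one[unfolded num_positive_eigenvalues_eq_1_iff[OF sym]]
  then obtain l u where u: "0 < l" "u \<noteq> 0" "Q *v u = l *\<^sub>R u"
    by (auto simp: positive_eigenvalues_def)
  have two: "Q *v w \<noteq> m *\<^sub>R w" if "w \<noteq> 0" "0 < m" "u \<bullet> w = 0" for w m
    using one' u that by blast
  have "x \<bullet> (Q *v x) \<le> 0" if x: "u \<bullet> x = 0" for x
  proof (rule ccontr)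
    assume "\<not> ?thesis"
    then have "\<exists>v\<in>{x. u \<bullet> x = 0}. \<exists>l>0. v \<noteq> 0 \<and> Q *v v = l *\<^sub>R v"
      using u x
      by (intro rayleigh_eigenvector[OF sym, of _ x])
         (auto simp: subspace_hyperplane simp flip: inner_symmetric_matrix[OF sym])
    then show False using two by blast
  qed
  then show ?thesis using that by blast
qed

text \<open>In general a limit of symmetric matrices has at most as many positive eigenvalues as the
  approximants, since being positive definite on a fixed subspace is an open condition; the
  vector \<open>e\<close> ensures that the one positive eigenvalue does not shrink to \<open>0\<close>.\<close>

lemma num_positive_eigenvalues_eq_1_limit:
  fixes Q :: "real^'n^'n" and R :: "'k \<Rightarrow> real^'n^'n"
  assumes F: "F \<noteq> bot"
    and symR: "\<And>k. transpose (R k) = R k" and sym: "transpose Q = Q"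
    and lim: "\<And>x. ((\<lambda>k. x \<bullet> (R k *v x)) \<longlongrightarrow> x \<bullet> (Q *v x)) F"
    and one: "\<forall>\<^sub>F k in F. num_positive_eigenvalues (R k) = 1"
    and e: "e \<bullet> (Q *v e) > 0"
  shows "num_positive_eigenvalues Q = 1"
  unfolding num_positive_eigenvalues_eq_1_iff[OF sym]
proof (intro conjI notI)
  show False if "positive_eigenvalues Q = {}"
    using rayleigh_eigenvector[OF sym subspace_UNIV _ _ e] that
    by (auto simp: positive_eigenvalues_def)
next
  assume "\<exists>v w l m. v \<noteq> 0 \<and> w \<noteq> 0 \<and> 0 < l \<and> 0 < m \<and> v \<bullet> w = 0 \<and>
        Q *v v = l *\<^sub>R v \<and> Q *v w = m *\<^sub>R w"
  then obtain v w l m where *: "v \<noteq> 0" "w \<noteq> 0" "0 < l" "0 < m" "v \<bullet> w = 0"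
    "Q *v v = l *\<^sub>R v" "Q *v w = m *\<^sub>R w" by blast
  \<comment> \<open>By polarization the off-diagonal entry on the plane spanned by \<open>v\<close> and \<open>w\<close> tends to \<open>0\<close>, while
    the diagonal entries have positive limits. Once they dominate, the restricted form is positive
    definite.\<close>
  have polar: "v \<bullet> (S *v w) =
      ((v + w) \<bullet> (S *v (v + w)) - v \<bullet> (S *v v) - w \<bullet> (S *v w)) / 2"
    if "transpose S = S" for S :: "real^'n^'n"
    using inner_symmetric_matrix[OF that, of v w]
    by (simp add: algebra_simps inner_commute)
  let ?b = "\<lambda>k. \<bar>v \<bullet> (R k *v w)\<bar>"
  have "((\<lambda>k. v \<bullet> (R k *v w)) \<longlongrightarrow> v \<bullet> (Q *v w)) F"
    unfolding polar[OF symR] polar[OF sym] by (intro tendsto_intros lim) simp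
  then have b: "(?b \<longlongrightarrow> 0) F"
    using * by (simp add: tendsto_rabs_zero)
  have big: "\<forall>\<^sub>F k in F. ?b k < x \<bullet> (R k *v x)" if "0 < x \<bullet> (Q *v x)" for x
  proof -
    have "((\<lambda>k. x \<bullet> (R k *v x) - ?b k) \<longlongrightarrow> x \<bullet> (Q *v x) - 0) F"
      by (intro tendsto_diff lim b)
    then have "\<forall>\<^sub>F k in F. 0 < x \<bullet> (R k *v x) - ?b k"
      using that by (intro order_tendstoD) auto
    then show ?thesis by (rule eventually_mono) simp
  qed
  have "\<forall>\<^sub>F k in F. num_positive_eigenvalues (R k) = 1 \<and>
      ?b k < v \<bullet> (R k *v v) \<and> ?b k < w \<bullet> (R k *v w)"
    using * by (intro eventually_conj one big) simp_all
  then obtain k where k: "num_positive_eigenvalues (R k) = 1"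
      "?b k < v \<bullet> (R k *v v)" "?b k < w \<bullet> (R k *v w)"
    using eventually_happens F by blast
  obtain u where u: "\<And>x. u \<bullet> x = 0 \<Longrightarrow> x \<bullet> (R k *v x) \<le> 0"
    using one_positive_eigenvalue_hyperplane[OF symR k(1)] by blast
  \<comment> \<open>A nonzero point in which the plane meets the hyperplane.\<close>
  obtain s t :: real where st: "s \<noteq> 0 \<or> t \<noteq> 0" "u \<bullet> (s *\<^sub>R v + t *\<^sub>R w) = 0"
  proof (cases "u \<bullet> v = 0")
    case True
    then show ?thesis using that[of 1 0] by simp
  next
    case False
    then show ?thesis using that[of "u \<bullet> w" "- (u \<bullet> v)"] by (simp add: inner_diff_right mult.commute)
  qed
  let ?B = "v \<bullet> (R k *v w)"
  have "2 * \<bar>s * t\<bar> \<le> s\<^sup>2 + t\<^sup>2"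
    using sum_squares_bound[of "\<bar>s\<bar>" "\<bar>t\<bar>"] by (simp add: abs_mult)
  then have "2 * \<bar>s * t\<bar> * ?b k \<le> (s\<^sup>2 + t\<^sup>2) * ?b k"
    by (rule mult_right_mono) simp
  moreover have "- (2 * \<bar>s * t\<bar> * ?b k) \<le> 2 * s * t * ?B"
    using abs_ge_minus_self[of "2 * s * t * ?B"] by (simp add: abs_mult)
  moreover have "(s\<^sup>2 + t\<^sup>2) * ?b k < s\<^sup>2 * (v \<bullet> (R k *v v)) + t\<^sup>2 * (w \<bullet> (R k *v w))"
  proof (cases "s = 0")
    case True
    then show ?thesis using st k by simp
  next
    case False
    then have "s\<^sup>2 * ?b k < s\<^sup>2 * (v \<bullet> (R k *v v))" using k by simp
    moreover have "t\<^sup>2 * ?b k \<le> t\<^sup>2 * (w \<bullet> (R k *v w))"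
      using k by (intro mult_left_mono) auto
    ultimately show ?thesis by (simp add: distrib_right)
  qed
  moreover have "(s *\<^sub>R v + t *\<^sub>R w) \<bullet> (R k *v (s *\<^sub>R v + t *\<^sub>R w)) =
      s\<^sup>2 * (v \<bullet> (R k *v v)) + 2 * s * t * ?B + t\<^sup>2 * (w \<bullet> (R k *v w))"
    using inner_symmetric_matrix[OF symR, of k v w]
    by (simp add: algebra_simps matrix_vector_mult_scaleR power2_eq_square inner_commute)
  ultimately show False using u[OF st(2)] by linarith
qed

section \<open>Self-dual cones\<close>

lemma self_dualD: "self_dual K \<Longrightarrow> y \<in> K \<Longrightarrow> x \<in> K \<Longrightarrow> 0 \<le> y \<bullet> x"
  unfolding self_dual_def dual_cone_def by blast

lemma self_dualI: "self_dual K \<Longrightarrow> (\<And>x. x \<in> K \<Longrightarrow> 0 \<le> y \<bullet> x) \<Longrightarrow> y \<in> K"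
  unfolding self_dual_def dual_cone_def by blast

lemma closed_self_dual:
  assumes "self_dual K"
  shows "closed K"
proof -
  have "K = (\<Inter>x\<in>K. {y. x \<bullet> y \<ge> 0})"
    using assms unfolding self_dual_def dual_cone_def by (simp add: inner_commute INTER_eq)
  moreover have "closed (\<Inter>x\<in>K. {y. x \<bullet> y \<ge> 0})"
    by (intro closed_INT ballI closed_halfspace_ge)
  ultimately show ?thesis by simp
qed

lemma scaleR_self_dual:
  "self_dual K \<Longrightarrow> x \<in> K \<Longrightarrow> 0 \<le> s \<Longrightarrow> s *\<^sub>R x \<in> K"
  by (rule self_dualI) (auto dest: self_dualD)

text \<open>For the first implication, \<open>z - s *\<^sub>R x\<close> stays in \<open>K\<close> for small \<open>s > 0\<close> and therefore pairs
  nonnegatively with \<open>x\<close>. For the second, compactness gives \<open>z \<bullet> x\<close> a positive lower bound \<open>m\<close> on the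
  unit vectors of \<open>K\<close>, and then the ball of radius \<open>m\<close> about \<open>z\<close> lies in the dual cone.\<close>

lemma interior_self_dual:
  assumes sd: "self_dual K"
  shows "z \<in> interior K \<longleftrightarrow> (\<forall>x\<in>K - {0}. z \<bullet> x > 0)"
proof
  assume "z \<in> interior K"
  then obtain r where r: "r > 0" "cball z r \<subseteq> K"
    by (meson mem_interior_cball)
  show "\<forall>x\<in>K - {0}. z \<bullet> x > 0"
  proof
    fix x assume x: "x \<in> K - {0}"
    define s where "s = r / norm x"
    have "s > 0" using r x by (simp add: s_def)
    have "z - s *\<^sub>R x \<in> cball z r"
      using r x by (simp add: dist_norm s_def)
    then have "0 \<le> (z - s *\<^sub>R x) \<bullet> x"
      using r x by (intro self_dualD[OF sd]) auto
    then have "s * (x \<bullet> x) \<le> z \<bullet> x" by (simp add: inner_diff_left)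
    moreover have "0 < s * (x \<bullet> x)" using \<open>s > 0\<close> x by simp
    ultimately show "z \<bullet> x > 0" by linarith
  qed
next
  assume pos: "\<forall>x\<in>K - {0}. z \<bullet> x > 0"
  let ?S = "K \<inter> sphere 0 1"
  have "\<exists>m>0. \<forall>x\<in>?S. m \<le> z \<bullet> x"
  proof (cases "?S = {}")
    case False
    moreover have "compact ?S"
      by (simp add: closed_Int_compact closed_self_dual[OF sd])
    moreover have "continuous_on ?S (\<lambda>x. z \<bullet> x)"
      by (intro continuous_intros)
    ultimately obtain x where "x \<in> ?S" "\<forall>y\<in>?S. z \<bullet> x \<le> z \<bullet> y"
      using continuous_attains_inf[of ?S "\<lambda>x. z \<bullet> x"] by blast
    then show ?thesis using pos by (intro exI[of _ "z \<bullet> x"]) auto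
  qed (auto intro: exI[of _ 1])
  then obtain m where m: "m > 0" "\<And>x. x \<in> ?S \<Longrightarrow> m \<le> z \<bullet> x" by blast
  have "ball z m \<subseteq> K"
  proof
    fix y assume y: "y \<in> ball z m"
    have "0 \<le> y \<bullet> x" if x: "x \<in> K" "x \<noteq> 0" for x
    proof -
      let ?x = "(1 / norm x) *\<^sub>R x"
      have S: "?x \<in> ?S" using x scaleR_self_dual[OF sd] by simp
      have "\<bar>(z - y) \<bullet> ?x\<bar> \<le> norm (z - y) * norm ?x" by (rule Cauchy_Schwarz_ineq2)
      also have "\<dots> < m" using y x by (simp add: dist_norm)
      finally have "z \<bullet> ?x - y \<bullet> ?x < m" unfolding inner_diff_left by linarith
      then have "0 \<le> y \<bullet> ?x" using m(2)[OF S] by linarith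
      then show ?thesis using x by (simp add: zero_le_divide_iff)
    qed
    then show "y \<in> K" by (intro self_dualI[OF sd]) (metis inner_zero_right order_refl)
  qed
  then show "z \<in> interior K" using m by (meson centre_in_ball interiorI open_ball)
qed

text \<open>A convex set without interior lies in a hyperplane. For a self-dual cone its normal vector would
  belong to the dual, hence to the cone, and be orthogonal to itself.\<close>

lemma interior_self_dual_nonempty:
  fixes K :: "(real^'n) set"
  assumes sd: "self_dual K" and "convex K"
  shows "interior K \<noteq> {}"
proof
  assume "interior K = {}"
  then obtain a b where a: "a \<noteq> 0" "K \<subseteq> {x. a \<bullet> x = b}"
    using empty_interior_subset_hyperplane[OF \<open>convex K\<close>] by blast
  have "0 \<in> K" by (rule self_dualI[OF sd]) simp
  then have "b = 0" using a(2) by auto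
  then have orth: "\<forall>x\<in>K. a \<bullet> x = 0" using a(2) by auto
  then have "a \<in> K" by (intro self_dualI[OF sd]) simp
  then have "a \<bullet> a = 0" using orth by blast
  then show False using a by simp
qed

text \<open>Were \<open>0\<close> interior, \<open>K\<close> would be \<open>{0}\<close>, whose dual is the whole space; that space is not \<open>{0}\<close>,
  because the index type is nonempty.\<close>

lemma zero_notin_interior_self_dual:
  fixes K :: "(real^'n) set"
  assumes sd: "self_dual K"
  shows "0 \<notin> interior K"
proof
  assume "0 \<in> interior K"
  then have sub: "K \<subseteq> {0}" unfolding interior_self_dual[OF sd, of 0] by auto
  then have "1 \<bullet> x = 0" if "x \<in> K" for x using that by auto
  then have "1 \<in> K" by (intro self_dualI[OF sd]) simp
  then show False using sub by auto
qed

section \<open>Interior directions suffice\<close>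

text \<open>The perturbed directions \<open>a + t *\<^sub>R e\<close> with \<open>e\<close> interior and \<open>t > 0\<close> are interior: their inner
  product with a nonzero element of \<open>K\<close> is a nonnegative number plus a positive one. The claim
  is the limit as \<open>t\<close> tends to \<open>0\<close>.\<close>

lemma one_positive_eigenvalue_closure:
  fixes f :: "real^'n \<Rightarrow> real" and K :: "(real^'n) set"
  assumes "2 \<le> d" "real_form d f" and sd: "self_dual K" and ne: "interior K \<noteq> {}"
    and int: "\<And>as. length as = d - 2 \<Longrightarrow> set as \<subseteq> interior K \<Longrightarrow>
       num_positive_eigenvalues (quad_matrix (iter_dir_deriv as f)) = 1"
    and as: "length as = d - 2" "set as \<subseteq> K"
    and pos: "x \<bullet> (quad_matrix (iter_dir_deriv as f) *v x) > 0"
  shows "num_positive_eigenvalues (quad_matrix (iter_dir_deriv as f)) = 1"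
proof -
  obtain c where c: "f = form_of d c" using assms(2) real_form_iff_form_of by blast
  have iter: "iter_dir_deriv bs f = form_of 2 (foldr deriv_coeffs bs c)"
    if "length bs = d - 2" for bs
  proof -
    have "2 + length bs = d" using that \<open>2 \<le> d\<close> by linarith
    then show ?thesis using iter_dir_deriv_form_of[of bs 2 c] by (simp add: c)
  qed
  obtain e where e: "e \<in> interior K" using ne by blast
  let ?as = "\<lambda>t::real. map (\<lambda>a. a + t *\<^sub>R e) as"
  let ?C = "\<lambda>bs. foldr deriv_coeffs bs c"
  let ?Q = "\<lambda>bs. quad_matrix (form_of 2 (?C bs))"
  have shift: "a + t *\<^sub>R e \<in> interior K" if "a \<in> K" "0 < t" for a t
    unfolding interior_self_dual[OF sd]
  proof
    fix x assume x: "x \<in> K - {0}"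
    then have "0 \<le> a \<bullet> x" "0 < e \<bullet> x"
      using self_dualD[OF sd, of a x] interior_self_dual[OF sd, of e] that e by auto
    then show "0 < (a + t *\<^sub>R e) \<bullet> x" using that by (simp add: inner_add_left add_nonneg_pos)
  qed
  have "num_positive_eigenvalues (?Q as) = 1"
  proof (rule num_positive_eigenvalues_eq_1_limit
      [where F = "at_right (0::real)" and R = "\<lambda>t. ?Q (?as t)"])
    show "transpose (?Q (?as t)) = ?Q (?as t)" for t by (rule quad_matrix_form_of)
    show "transpose (?Q as) = ?Q as" by (rule quad_matrix_form_of)
    show "((\<lambda>t. y \<bullet> (?Q (?as t) *v y)) \<longlongrightarrow> y \<bullet> (?Q as *v y)) (at_right 0)" for y
      unfolding quad_matrix_form_of(2)[symmetric]
      by (intro tendsto_form_of tendsto_foldr_deriv_coeffs tendsto_ident_at)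
    have "num_positive_eigenvalues (?Q (?as t)) = 1" if "0 < t" for t
    proof -
      have "set (?as t) \<subseteq> interior K" using shift as that by auto
      then show ?thesis using int[of "?as t"] iter[of "?as t"] as by simp
    qed
    then show "\<forall>\<^sub>F t in at_right 0. num_positive_eigenvalues (?Q (?as t)) = 1"
      using eventually_at_right_less[of "0::real"] by (rule eventually_mono[rotated])
    show "x \<bullet> (?Q as *v x) > 0" using pos iter as by simp
  qed simp
  then show ?thesis using iter as by simp
qed

theorem theorem5p3:
  fixes f :: "real^'n \<Rightarrow> real" and K :: "(real^'n) set" and d :: nat
  assumes "2 \<le> d" and "real_form d f" and "convex_cone K" and "self_dual K"
  shows "f \<in> SL_ring d K \<longleftrightarrow>
    (\<forall>as. length as = d - 2 \<and> set as \<subseteq> K - {0} \<longrightarrow>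
       (let Q = quad_matrix (iter_dir_deriv as f) in
          (K_positive K Q \<and> invertible Q) \<and>
          num_positive_eigenvalues Q = 1))"
proof -
  note sd = \<open>self_dual K\<close>
  let ?Q = "\<lambda>as. quad_matrix (iter_dir_deriv as f)"
  have sub: "interior K \<subseteq> K - {0}"
    using interior_subset zero_notin_interior_self_dual[OF sd] by auto
  have ne: "interior K \<noteq> {}"
    using interior_self_dual_nonempty[OF sd] \<open>convex_cone K\<close> by (simp add: convex_cone_def)
  have Kpos: "K_positive K M \<longleftrightarrow> (\<forall>x\<in>K - {0}. \<forall>y\<in>K - {0}. x \<bullet> (M *v y) > 0)" for M
    unfolding K_positive_def interior_self_dual[OF sd] by (auto simp: inner_commute)
  show ?thesis
  proof
    assume SL: "f \<in> SL_ring d K"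
    show "\<forall>as. length as = d - 2 \<and> set as \<subseteq> K - {0} \<longrightarrow>
       (let Q = ?Q as in (K_positive K Q \<and> invertible Q) \<and> num_positive_eigenvalues Q = 1)"
    proof (intro allI impI)
      fix as assume as: "length as = d - 2 \<and> set as \<subseteq> K - {0}"
      have inv: "invertible (?Q as)" and
        pos: "\<forall>x\<in>K - {0}. \<forall>y\<in>K - {0}. x \<bullet> (?Q as *v y) > 0"
        using SL as by (auto simp: SL_ring_def Let_def)
      obtain e where e: "e \<in> K - {0}" using ne sub by blast
      have "num_positive_eigenvalues (?Q as) = 1"
      proof (rule one_positive_eigenvalue_closure[OF assms(1,2) sd ne])
        show "num_positive_eigenvalues (?Q bs) = 1"
          if "length bs = d - 2" "set bs \<subseteq> interior K" for bs
          using SL that by (auto simp: SL_ring_def K_Lorentzian_def Let_def)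
        show "e \<bullet> (?Q as *v e) > 0" using pos e by blast
      qed (use as in auto)
      then show "let Q = ?Q as in (K_positive K Q \<and> invertible Q) \<and> num_positive_eigenvalues Q = 1"
        using inv pos by (simp add: Kpos)
    qed
  next
    assume R: "\<forall>as. length as = d - 2 \<and> set as \<subseteq> K - {0} \<longrightarrow>
       (let Q = ?Q as in (K_positive K Q \<and> invertible Q) \<and> num_positive_eigenvalues Q = 1)"
    have "invertible (?Q as)" "num_positive_eigenvalues (?Q as) = 1"
      "\<forall>x\<in>K - {0}. \<forall>y\<in>K - {0}. x \<bullet> (?Q as *v y) > 0"
      if "length as = d - 2" "set as \<subseteq> K - {0}" for as
      using R that by (auto simp: Let_def Kpos)
    then show "f \<in> SL_ring d K"
      using assms(1,2) sub unfolding SL_ring_def K_Lorentzian_def Let_def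
      by (smt (verit, best) mem_Collect_eq subset_iff)
  qed
qed

end
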